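(* Let $q$ be a complex number with $0<|q|<1$, and let $x,y$ be complex numbers with $x\neq y$ such that no denominator below vanishes, i.e. $xq^{k+1}\neq 1$, $yq^{k+1}\neq 1$ and $xyq^{k}\neq 1$ for all integers $k\ge 0$. Then $$\sum_{n\geq 1} (-1)^n q^{n(n-1)/2}\, \frac{x^n-y^n}{x-y}=-(q,qx,qy;q)_\infty \sum_{n\geq 0}\frac{(xy;q)_{2n}\, q^n}{(q,qx,qy,xy;q)_n}.$$
   Context: For complex $a,q$ with $0<|q|<1$ and an integer $n\ge 0$, the $q$-shifted factorial is $(a;q)_n=\prod_{j=0}^{n-1}(1-aq^j)$ for $n>0$ and $(a;q)_0=1$; moreover $(a;q)_\infty=\lim_{n\to\infty}(a;q)_n=\prod_{j\ge 0}(1-aq^j)$. Also $(a_1,\dots,a_m;q)_n=(a_1;q)_n\cdots(a_m;q)_n$, and likewise for $n=\infty$. *)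

theory Defs
  imports Complex_Main
begin

definition qpoch :: "complex \<Rightarrow> complex \<Rightarrow> nat \<Rightarrow> complex" where
  "qpoch a q n = (\<Prod>j<n. 1 - a * q ^ j)"

text \<open>The limit exists whenever \<^term>\<open>norm q < 1\<close>.\<close>

definition qpoch_inf :: "complex \<Rightarrow> complex \<Rightarrow> complex" where
  "qpoch_inf a q = lim (\<lambda>n. qpoch a q n)"

definition qpochs :: "complex list \<Rightarrow> complex \<Rightarrow> nat \<Rightarrow> complex" where
  "qpochs as q n = (\<Prod>a\<leftarrow>as. qpoch a q n)"

definition qpochs_inf :: "complex list \<Rightarrow> complex \<Rightarrow> complex" where
  "qpochs_inf as q = (\<Prod>a\<leftarrow>as. qpoch_inf a q)"

end

theory Submission
  imports Defs "HOL-Analysis.Infinite_Products"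
begin

text \<open>
  The negatives of both sides, regarded as functions $F(x,y)$, satisfy the same inhomogeneous functional equation
  \[ F(x,y) + q(x+y)\,F(qx,qy) + q^3xy\,F(q^2x,q^2y) = 1, \]
  and this equation has at most one solution that stays bounded along the points
  $(q^mx, q^my)$, $m \ge 0$: the difference $d_m$ of two solutions at these points satisfies a
  homogeneous recurrence $d_m = a_m d_{m+1} + b_m d_{m+2}$ with $a_m, b_m \to 0$, which leaves only
  $d = 0$ (\<open>bounded_recurrence_zero\<close>).

  On the series side, $F(x,y) = (x\psi(x) - y\psi(y))/(x-y)$ for the partial theta
  function $\psi(z) = \sum_{n\ge0} (-1)^n q^{n(n+1)/2} z^n$. The equation follows by applying
  $\psi(z) = 1 - qz\,\psi(qz)$ twice (\<open>theta_quotient_rec\<close>).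

  On the product side, absorbing the infinite products into the sum cancels all denominators:
  \[ (q,qx,qy;q)_\infty \sum_{n\ge0} \frac{(xy;q)_{2n}\,q^n}{(q,qx,qy,xy;q)_n}
     = \sum_{n\ge0} T_n(x,y), \quad
     T_n(x,y) = q^n (q^{n+1}, xq^{n+1}, yq^{n+1};q)_\infty (xyq^n;q)_n. \]
  The functional equation becomes visible when the three sums are combined with a shift of their
  indices, because $T_n(x,y)$, $T_{n-1}(qx,qy)$ and $T_{n-2}(q^2x,q^2y)$ share the factors
  $(xq^{n+1},yq^{n+1};q)_\infty$. Writing $V_n = (q^n, xq^n, yq^n;q)_\infty (xyq^{n+1};q)_{n-1}$,
  one finds
  \[ T_n(x,y) + q(x+y)\,T_{n-1}(qx,qy) + q^3xy\,T_{n-2}(q^2x,q^2y) = V_{n+1} - V_n, \]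
  where summands of negative index count as zero and $V_0 = 0$ on account of the factor
  $1 - q^0$. Hence the combination telescopes to $\lim_n V_n = 1$
  (\<open>product_term_telescope\<close>, \<open>product_sum_rec\<close>).
\<close>

section \<open>The $q$-shifted factorial\<close>

lemma qpoch_0 [simp]: "qpoch a q 0 = 1"
  by (simp add: qpoch_def)

lemma qpoch_Suc: "qpoch a q (Suc n) = qpoch a q n * (1 - a * q ^ n)"
  by (simp add: qpoch_def)

lemma qpoch_add: "qpoch a q (m + n) = qpoch a q m * qpoch (a * q ^ m) q n"
  by (induction n) (simp_all add: qpoch_Suc power_add mult_ac)

lemma qpoch_Suc_left: "qpoch a q (Suc n) = (1 - a) * qpoch (a * q) q n"
  using qpoch_add[of a q 1 n] by (simp add: qpoch_Suc)

lemma qpoch_nonzero: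
  assumes "\<And>k. a * q ^ k \<noteq> 1"
  shows "qpoch a q n \<noteq> 0"
  using assms by (simp add: qpoch_def eq_iff_diff_eq_0[of 1, symmetric] eq_commute[of 1])

text \<open>
  $\prod_{j} (1 + r|q|^j) \le \exp (r / (1 - |q|))$, so this bounds $(a;q)_n$ for every $n$ and
  every $|a| \le r$.
\<close>

definition qpoch_bound :: "complex \<Rightarrow> real \<Rightarrow> real" where
  "qpoch_bound q r = exp (r / (1 - norm q))"

text \<open>
  Bounding the distance to $1$ rather than the size serves twice: it yields boundedness, and, as the
  bound vanishes with $a$, it also yields limits of products whose length grows while $a \to 0$.
\<close>

lemma qpoch_minus_1_le:
  assumes "norm q < 1"
  shows "norm (qpoch a q n - 1) \<le> qpoch_bound q (norm a) - 1"
proof -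
  have "norm (qpoch a q n - 1) = norm ((\<Prod>j<n. 1 + (- a * q ^ j)) - 1)"
    by (simp add: qpoch_def)
  also have "\<dots> \<le> (\<Prod>j<n. 1 + norm (- a * q ^ j)) - 1"
    by (rule norm_prod_minus1_le_prod_minus1)
  also have "(\<Prod>j<n. 1 + norm (- a * q ^ j)) \<le> (\<Prod>j<n. exp (norm a * norm q ^ j))"
    by (intro prod_mono) (auto simp: norm_mult norm_power intro: add_nonneg_nonneg)
  also have "\<dots> = exp (norm a * (\<Sum>j<n. norm q ^ j))"
    by (simp add: exp_sum sum_distrib_left)
  also have "\<dots> \<le> exp (norm a * (1 / (1 - norm q)))"
    using assms sum_le_suminf[of "\<lambda>j. norm q ^ j" "{..<n}"]
    by (simp only: exp_le_cancel_iff) (intro mult_left_mono; simp add: suminf_geometric summable_geometric)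
  finally show ?thesis by (simp add: qpoch_bound_def)
qed

lemma norm_qpoch_le:
  assumes "norm q < 1" "norm a \<le> r"
  shows "norm (qpoch a q n) \<le> qpoch_bound q r"
proof -
  have "norm (qpoch a q n) \<le> norm (qpoch a q n - 1) + 1"
    using norm_triangle_ineq[of "qpoch a q n - 1" 1] by simp
  also have "\<dots> \<le> qpoch_bound q (norm a)"
    using qpoch_minus_1_le[OF assms(1), of a n] by simp
  also have "\<dots> \<le> qpoch_bound q r"
    using assms by (auto simp: qpoch_bound_def divide_right_mono)
  finally show ?thesis .
qed

lemma convergent_prod_qpoch:
  fixes a q :: complex
  assumes "norm q < 1"
  shows "convergent_prod (\<lambda>n. 1 - a * q ^ n)"
proof -
  have "summable (\<lambda>n. norm a * norm q ^ n)"
    using assms by (intro summable_mult summable_geometric) simp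
  then have "summable (\<lambda>n. norm ((1 - a * q ^ n) - 1))"
    by (simp add: norm_mult norm_power del: summable_cmult_iff)
  then show ?thesis
    by (intro abs_convergent_prod_imp_convergent_prod summable_imp_abs_convergent_prod)
qed

lemma qpoch_tendsto_qpoch_inf:
  assumes "norm q < 1"
  shows "(\<lambda>n. qpoch a q n) \<longlonglongrightarrow> qpoch_inf a q"
proof -
  have "convergent (\<lambda>n. qpoch a q (Suc n))"
    using convergent_prod_imp_convergent[OF convergent_prod_qpoch[OF assms]]
    by (simp add: qpoch_def lessThan_Suc_atMost)
  then have "convergent (\<lambda>n. qpoch a q n)"
    by (rule convergent_Suc_iff[THEN iffD1])
  then show ?thesis
    by (simp add: qpoch_inf_def convergent_LIMSEQ_iff)
qed

lemma qpoch_inf_nonzero: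
  assumes "norm q < 1" "\<And>k. a * q ^ k \<noteq> 1"
  shows "qpoch_inf a q \<noteq> 0"
proof
  assume "qpoch_inf a q = 0"
  with qpoch_tendsto_qpoch_inf[OF assms(1), of a] have "(\<lambda>n. qpoch a q (Suc n)) \<longlonglongrightarrow> 0"
    by (auto dest: LIMSEQ_Suc)
  then have "\<exists>k. 1 - a * q ^ k = 0"
    using convergent_prod_to_zero_iff[OF convergent_prod_qpoch[OF assms(1), of a]]
    by (simp add: qpoch_def lessThan_Suc_atMost)
  then show False
    using assms(2) by (metis eq_iff_diff_eq_0)
qed

lemma qpoch_inf_split:
  assumes "norm q < 1"
  shows "qpoch_inf a q = qpoch a q n * qpoch_inf (a * q ^ n) q"
proof (rule LIMSEQ_unique)
  show "(\<lambda>m. qpoch a q (m + n)) \<longlonglongrightarrow> qpoch_inf a q"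
    using qpoch_tendsto_qpoch_inf[OF assms] by (rule LIMSEQ_ignore_initial_segment)
  have "(\<lambda>m. qpoch a q n * qpoch (a * q ^ n) q m)
      \<longlonglongrightarrow> qpoch a q n * qpoch_inf (a * q ^ n) q"
    by (intro tendsto_intros qpoch_tendsto_qpoch_inf assms)
  then show "(\<lambda>m. qpoch a q (m + n)) \<longlonglongrightarrow> qpoch a q n * qpoch_inf (a * q ^ n) q"
    by (simp add: qpoch_add add.commute[of _ n])
qed

lemma qpoch_inf_rec:
  assumes "norm q < 1"
  shows "qpoch_inf a q = (1 - a) * qpoch_inf (a * q) q"
  using qpoch_inf_split[OF assms, of a 1] by (simp add: qpoch_Suc)

lemma norm_qpoch_inf_le:
  assumes "norm q < 1" "norm a \<le> r"
  shows "norm (qpoch_inf a q) \<le> qpoch_bound q r"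
  using tendsto_norm[OF qpoch_tendsto_qpoch_inf[OF assms(1), of a]]
  by (rule LIMSEQ_le_const2) (use norm_qpoch_le[OF assms] in blast)

lemma qpoch_inf_minus_1_le:
  assumes "norm q < 1"
  shows "norm (qpoch_inf a q - 1) \<le> qpoch_bound q (norm a) - 1"
  using tendsto_norm[OF tendsto_diff[OF qpoch_tendsto_qpoch_inf[OF assms, of a] tendsto_const]]
  by (rule LIMSEQ_le_const2) (use qpoch_minus_1_le[OF assms] in blast)

text \<open>
  Used with $u_n = (a_n;q)_\infty$ and with $u_n = (a_n;q)_{k_n}$ for a varying length $k_n$.
\<close>

lemma tendsto_1_of_qpoch_bound:
  assumes "a \<longlonglongrightarrow> 0" and "\<And>n. norm (u n - 1) \<le> qpoch_bound q (norm (a n)) - 1"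
  shows "u \<longlonglongrightarrow> (1 :: complex)"
proof -
  have "(\<lambda>n. norm (a n)) \<longlonglongrightarrow> 0"
    using assms(1) by (rule tendsto_norm_zero)
  then have "(\<lambda>n. exp (norm (a n) * inverse (1 - norm q)) - 1) \<longlonglongrightarrow> exp (0 * inverse (1 - norm q)) - 1"
    by (intro tendsto_intros)
  then have "(\<lambda>n. qpoch_bound q (norm (a n)) - 1) \<longlonglongrightarrow> 0"
    by (simp add: qpoch_bound_def divide_inverse)
  then have "(\<lambda>n. u n - 1) \<longlonglongrightarrow> 0"
    by (rule Lim_null_comparison[rotated]) (use assms(2) in simp)
  then show ?thesis
    by (simp add: LIM_zero_iff)
qed

section \<open>The partial theta function\<close>

definition partial_theta :: "complex \<Rightarrow> complex \<Rightarrow> complex" where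
  "partial_theta q z = (\<Sum>n. (-1) ^ n * q ^ (n * (n + 1) div 2) * z ^ n)"

lemma triangle_Suc: "Suc n * (Suc n + 1) div 2 = n * (n + 1) div 2 + Suc n"
proof -
  have "Suc n * (Suc n + 1) = n * (n + 1) + Suc n * 2" by simp
  then show ?thesis by (metis div_mult_self1 zero_neq_numeral add.commute)
qed

lemma summable_partial_theta:
  assumes "norm q < 1"
  shows "summable (\<lambda>n. (-1) ^ n * q ^ (n * (n + 1) div 2) * (z :: complex) ^ n)"
proof -
  let ?t = "\<lambda>n. (-1) ^ n * q ^ (n * (n + 1) div 2) * z ^ n"
  have "(\<lambda>n. norm q ^ Suc n * norm z) \<longlonglongrightarrow> 0"
    using assms by (intro tendsto_mult_left_zero LIMSEQ_Suc LIMSEQ_power_zero) simp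
  then have "eventually (\<lambda>n. norm q ^ Suc n * norm z < 1 / 2) sequentially"
    by (rule order_tendstoD) simp
  then obtain N where N: "\<And>n. n \<ge> N \<Longrightarrow> norm q ^ Suc n * norm z < 1 / 2"
    by (auto simp: eventually_sequentially)
  show ?thesis
  proof (rule summable_ratio_test[of "1 / 2" N])
    fix n assume "N \<le> n"
    have "norm (?t (Suc n)) = (norm q ^ Suc n * norm z) * norm (?t n)"
      unfolding triangle_Suc by (simp add: norm_mult norm_power power_add mult_ac)
    also have "\<dots> \<le> 1 / 2 * norm (?t n)"
      using N[OF \<open>N \<le> n\<close>] by (intro mult_right_mono) auto
    finally show "norm (?t (Suc n)) \<le> 1 / 2 * norm (?t n)" .
  qed simp
qed

lemma partial_theta_rec:
  assumes "norm q < 1"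
  shows "partial_theta q z = 1 - q * z * partial_theta q (q * z)"
proof -
  let ?t = "\<lambda>z n. (-1) ^ n * q ^ (n * (n + 1) div 2) * z ^ n"
  have head: "partial_theta q z = ?t z 0 + (\<Sum>n. ?t z (Suc n))"
    unfolding partial_theta_def using suminf_split_head[OF summable_partial_theta[OF assms, of z]] by (simp only: algebra_simps)
  have "?t z (Suc n) = - (q * z) * ?t (q * z) n" for n
    unfolding triangle_Suc by (simp add: power_add power_mult_distrib mult_ac)
  then have tail: "(\<Sum>n. ?t z (Suc n)) = - (q * z) * partial_theta q (q * z)"
    unfolding partial_theta_def by (simp only: suminf_mult[OF summable_partial_theta[OF assms]])
  show ?thesis
    unfolding head tail by simp
qed

text \<open>
  A power series is continuous at the origin. The limit serves to bound the partial theta function,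
  and with it its difference quotient below, along the points $q^m z$.
\<close>

lemma partial_theta_tendsto:
  assumes "norm q < 1"
  shows "(\<lambda>m. partial_theta q (q ^ m * z)) \<longlonglongrightarrow> partial_theta q 0"
proof -
  let ?c = "\<lambda>n. (-1) ^ n * q ^ (n * (n + 1) div 2)"
  have "isCont (\<lambda>z. \<Sum>n. ?c n * z ^ n) 0"
    by (rule isCont_powser[OF summable_partial_theta[OF assms, of 1]]) simp
  moreover have "(\<lambda>m. q ^ m * z) \<longlonglongrightarrow> 0"
    using assms by (intro tendsto_mult_left_zero LIMSEQ_power_zero)
  ultimately show ?thesis
    unfolding partial_theta_def by (rule isCont_tendsto_compose)
qed

text \<open>
  Termwise, this is $\sum_{n\ge0} (-1)^n q^{n(n+1)/2} (x^{n+1} - y^{n+1})/(x-y)$, the negative of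
  the series in question with its summation index lowered by one.
\<close>

definition theta_quotient :: "complex \<Rightarrow> complex \<Rightarrow> complex \<Rightarrow> complex" where
  "theta_quotient q x y = (x * partial_theta q x - y * partial_theta q y) / (x - y)"

text \<open>
  Replacing $(x,y)$ by $(q^mx,q^my)$ multiplies numerator and denominator of the quotient by $q^m$,
  so in each of the three terms the denominator is $x - y$ and the numerator is a function of $x$
  and $y$ minus the same function with $x$ and $y$ exchanged. By the recurrence of the partial theta
  function, the combination of the first functions is $x + qxy$; the symmetric part $qxy$ drops out.
\<close>

lemma theta_quotient_rec:
  assumes "norm q < 1" "q \<noteq> 0" "x \<noteq> y"
  shows "theta_quotient q x y + q * (x + y) * theta_quotient q (q * x) (q * y)
    + q ^ 3 * (x * y) * theta_quotient q (q\<^sup>2 * x) (q\<^sup>2 * y) = 1"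
proof -
  define a where "a = (\<lambda>m z. partial_theta q (q ^ m * z))"
  have step: "a m z = 1 - q ^ Suc m * z * a (Suc m) z" for m z
    unfolding a_def using partial_theta_rec[OF assms(1), of "q ^ m * z"] by (simp add: mult_ac)
  have cancel: "theta_quotient q (q ^ m * x) (q ^ m * y) = (x * a m x - y * a m y) / (x - y)" for m
  proof -
    have "theta_quotient q (q ^ m * x) (q ^ m * y)
        = (q ^ m * (x * a m x - y * a m y)) / (q ^ m * (x - y))"
      by (simp add: theta_quotient_def a_def algebra_simps)
    then show ?thesis using assms(2) by simp
  qed
  have one: "z * a 0 z + q * (z + z') * (z * a 1 z) + q ^ 3 * (z * z') * (z * a 2 z)
      = z + q * (z * z')" for z z'
  proof -
    have "a 0 z = 1 - q * z * a 1 z" "a 1 z = 1 - q\<^sup>2 * z * a 2 z"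
      using step[of 0 z] step[of 1 z] by (simp_all add: numeral_2_eq_2)
    then show ?thesis by algebra
  qed
  have vals: "theta_quotient q x y = (x * a 0 x - y * a 0 y) / (x - y)"
    "theta_quotient q (q * x) (q * y) = (x * a 1 x - y * a 1 y) / (x - y)"
    "theta_quotient q (q\<^sup>2 * x) (q\<^sup>2 * y) = (x * a 2 x - y * a 2 y) / (x - y)"
    using cancel[of 0] cancel[of 1] cancel[of 2] by simp_all
  have combine: "A / D + s * (B / D) + t * (C / D) = (A + s * B + t * C) / D" for A B C D s t :: complex
    by (simp add: add_divide_distrib)
  have "theta_quotient q x y + q * (x + y) * theta_quotient q (q * x) (q * y)
      + q ^ 3 * (x * y) * theta_quotient q (q\<^sup>2 * x) (q\<^sup>2 * y)
    = ((x * a 0 x + q * (x + y) * (x * a 1 x) + q ^ 3 * (x * y) * (x * a 2 x))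
      - (y * a 0 y + q * (y + x) * (y * a 1 y) + q ^ 3 * (y * x) * (y * a 2 y))) / (x - y)"
    unfolding vals combine by (simp add: algebra_simps)
  also have "\<dots> = 1"
    unfolding one using assms(3) by (simp add: mult.commute)
  finally show ?thesis .
qed

lemma Bseq_theta_quotient:
  assumes "norm q < 1" "q \<noteq> 0"
  shows "Bseq (\<lambda>m. theta_quotient q (q ^ m * x) (q ^ m * y))"
proof -
  have "theta_quotient q (q ^ m * x) (q ^ m * y)
      = (q ^ m * (x * partial_theta q (q ^ m * x) - y * partial_theta q (q ^ m * y)))
        / (q ^ m * (x - y))" for m
    by (simp add: theta_quotient_def algebra_simps)
  then have "theta_quotient q (q ^ m * x) (q ^ m * y)
      = x / (x - y) * partial_theta q (q ^ m * x) + - y / (x - y) * partial_theta q (q ^ m * y)" for m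
    using assms(2) by (simp add: diff_divide_distrib)
  moreover have "convergent (\<lambda>m. x / (x - y) * partial_theta q (q ^ m * x) + - y / (x - y) * partial_theta q (q ^ m * y))"
    by (rule convergentI[OF tendsto_add[OF
        tendsto_mult[OF tendsto_const partial_theta_tendsto[OF assms(1)]]
        tendsto_mult[OF tendsto_const partial_theta_tendsto[OF assms(1)]]]])
  ultimately show ?thesis
    by (simp only: convergent_imp_Bseq)
qed

section \<open>The product side\<close>

text \<open>
  The $n$-th term of the sum on the product side multiplied by $(q,qx,qy;q)_\infty$. In this form it
  is meaningful for all $x$ and $y$, which allows both to be scaled by $q$.
\<close>

definition product_term :: "complex \<Rightarrow> complex \<Rightarrow> complex \<Rightarrow> nat \<Rightarrow> complex" where
  "product_term q x y n = q ^ n * qpoch_inf (q ^ (n + 1)) q * qpoch_inf (x * q ^ (n + 1)) q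
     * qpoch_inf (y * q ^ (n + 1)) q * qpoch (x * y * q ^ n) q n"

definition product_sum :: "complex \<Rightarrow> complex \<Rightarrow> complex \<Rightarrow> complex" where
  "product_sum q x y = (\<Sum>n. product_term q x y n)"

lemma norm_mult_power_le:
  fixes a q :: complex
  assumes "norm q < 1" "norm a \<le> r"
  shows "norm (a * q ^ n) \<le> r"
  using assms mult_mono[of "norm a" r "norm q ^ n" 1] order_trans[OF norm_ge_zero assms(2)]
  by (simp add: norm_mult norm_power power_le_one)

text \<open>
  The bound is uniform over $|x| \le r$, $|y| \le r'$: besides summability it gives boundedness of
  the sum along $(q^mx,q^my)$.
\<close>

lemma norm_product_term_le:
  assumes "norm q < 1" "norm x \<le> r" "norm y \<le> r'"
  shows "norm (product_term q x y n)
    \<le> qpoch_bound q 1 * qpoch_bound q r * qpoch_bound q r' * qpoch_bound q (r * r') * norm q ^ n"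
proof -
  have "norm (x * y) \<le> r * r'"
    using assms order_trans[OF norm_ge_zero assms(2)] by (simp add: norm_mult mult_mono)
  then have 4: "norm (qpoch (x * y * q ^ n) q n) \<le> qpoch_bound q (r * r')"
    by (intro norm_qpoch_le norm_mult_power_le assms)
  have 1: "norm (qpoch_inf (q ^ (n + 1)) q) \<le> qpoch_bound q 1"
    using norm_mult_power_le[OF assms(1), of 1 1 "n + 1"] by (intro norm_qpoch_inf_le assms) simp
  have 2: "norm (qpoch_inf (x * q ^ (n + 1)) q) \<le> qpoch_bound q r"
    by (intro norm_qpoch_inf_le norm_mult_power_le assms)
  have 3: "norm (qpoch_inf (y * q ^ (n + 1)) q) \<le> qpoch_bound q r'"
    by (intro norm_qpoch_inf_le norm_mult_power_le assms)
  have "norm (qpoch_inf (q ^ (n + 1)) q) * norm (qpoch_inf (x * q ^ (n + 1)) q)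
      * norm (qpoch_inf (y * q ^ (n + 1)) q) * norm (qpoch (x * y * q ^ n) q n)
    \<le> qpoch_bound q 1 * qpoch_bound q r * qpoch_bound q r' * qpoch_bound q (r * r')"
    by (intro mult_mono 1 2 3 4) (auto simp: qpoch_bound_def)
  then have "norm q ^ n * (norm (qpoch_inf (q ^ (n + 1)) q) * norm (qpoch_inf (x * q ^ (n + 1)) q)
      * norm (qpoch_inf (y * q ^ (n + 1)) q) * norm (qpoch (x * y * q ^ n) q n))
    \<le> norm q ^ n * (qpoch_bound q 1 * qpoch_bound q r * qpoch_bound q r' * qpoch_bound q (r * r'))"
    by (rule mult_left_mono) simp
  then show ?thesis
    unfolding product_term_def norm_mult norm_power by (simp only: mult_ac)
qed

lemma summable_product_term:
  assumes "norm q < 1"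
  shows "summable (product_term q x y)"
  by (rule summable_comparison_test'[OF _ norm_product_term_le[OF assms order_refl order_refl]])
    (use assms in \<open>auto intro!: summable_mult summable_geometric\<close>)

lemma Bseq_product_sum:
  assumes "norm q < 1"
  shows "Bseq (\<lambda>m. product_sum q (q ^ m * x) (q ^ m * y))"
proof -
  let ?C = "qpoch_bound q 1 * qpoch_bound q (norm x) * qpoch_bound q (norm y)
    * qpoch_bound q (norm x * norm y)"
  have geom: "summable (\<lambda>n. ?C * norm q ^ n)"
    using assms by (intro summable_mult summable_geometric) simp
  have "norm (product_sum q (q ^ m * x) (q ^ m * y)) \<le> (\<Sum>n. ?C * norm q ^ n)" for m
    unfolding product_sum_def
  proof (rule norm_suminf_le[OF _ geom])
    show "norm (product_term q (q ^ m * x) (q ^ m * y) n) \<le> ?C * norm q ^ n" for n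
      using norm_mult_power_le[OF assms order_refl, of x m] norm_mult_power_le[OF assms order_refl, of y m]
      by (intro norm_product_term_le assms) (simp_all add: mult.commute)
  qed
  then show ?thesis by (rule BseqI')
qed

text \<open>
  The right-hand side is $V_{M+2}$ in the notation of the introduction. It arises from the ansatz
  $V_n = (q^n, xq^n, yq^n;q)_\infty\, r_n(xy)$: comparing the coefficients of $x + y$ in the
  telescoping relation, with $x + y$ and $xy$ treated as independent, gives
  $r_n(w) = (wq^{n+1};q)_{n-1}$. The three ranges of summation have different lengths so that the step from
  $M$ to $M + 1$ adds exactly $T_{M+2}(x,y)$, $T_{M+1}(qx,qy)$ and $T_M(q^2x,q^2y)$, all of which
  are polynomial multiples of one product \<open>K\<close>; dividing by \<open>K\<close> leaves a
  polynomial identity in $x$, $y$, $q$ and $Q = q^M$.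
\<close>

lemma product_term_telescope:
  assumes "norm q < 1"
  shows "(\<Sum>n<M + 2. product_term q x y n)
      + q * (x + y) * (\<Sum>n<M + 1. product_term q (q * x) (q * y) n)
      + q ^ 3 * (x * y) * (\<Sum>n<M. product_term q (q\<^sup>2 * x) (q\<^sup>2 * y) n)
    = qpoch_inf (q ^ (M + 2)) q * qpoch_inf (x * q ^ (M + 2)) q * qpoch_inf (y * q ^ (M + 2)) q
      * qpoch (x * y * q ^ (M + 3)) q (M + 1)"
proof (induction M)
  case 0
  define K where "K = qpoch_inf (q ^ 2) q * qpoch_inf (x * q ^ 2) q * qpoch_inf (y * q ^ 2) q"
  have e: "qpoch_inf q q = (1 - q) * qpoch_inf (q ^ 2) q"
    "qpoch_inf (x * q) q = (1 - x * q) * qpoch_inf (x * q ^ 2) q"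
    "qpoch_inf (y * q) q = (1 - y * q) * qpoch_inf (y * q ^ 2) q"
    using qpoch_inf_rec[OF assms, of q] qpoch_inf_rec[OF assms, of "x * q"]
      qpoch_inf_rec[OF assms, of "y * q"]
    by (simp_all only: power2_eq_square mult.assoc)
  have t: "product_term q x y 0 = K * ((1 - q) * (1 - x * q) * (1 - y * q))"
    "product_term q x y 1 = K * (q * (1 - x * y * q))"
    "product_term q (q * x) (q * y) 0 = K * (1 - q)"
  proof -
    show "product_term q x y 0 = K * ((1 - q) * (1 - x * q) * (1 - y * q))"
      by (simp add: product_term_def K_def e)
    show "product_term q x y 1 = K * (q * (1 - x * y * q))"
      by (simp add: product_term_def K_def qpoch_Suc power2_eq_square)
    show "product_term q (q * x) (q * y) 0 = K * (1 - q)"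
      by (simp add: product_term_def K_def e(1) power2_eq_square mult_ac)
  qed
  have "(\<Sum>n<0 + 2. product_term q x y n)
      + q * (x + y) * (\<Sum>n<0 + 1. product_term q (q * x) (q * y) n)
      + q ^ 3 * (x * y) * (\<Sum>n<0. product_term q (q\<^sup>2 * x) (q\<^sup>2 * y) n)
    = product_term q x y 0 + product_term q x y 1 + q * (x + y) * product_term q (q * x) (q * y) 0"
    by (simp add: numeral_2_eq_2)
  also have "\<dots> = K * (1 - x * y * q ^ 3)"
    unfolding t by (simp add: algebra_simps power3_eq_cube)
  finally show ?case
    by (simp add: K_def qpoch_Suc power2_eq_square power3_eq_cube mult.assoc)
next
  case (Suc M)
  define w where "w = x * y"
  define Q where "Q = q ^ M"
  define K where "K = qpoch_inf (q ^ (M + 3)) q * qpoch_inf (x * q ^ (M + 3)) q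
    * qpoch_inf (y * q ^ (M + 3)) q * qpoch (w * q ^ (M + 4)) q M"
  have E: "qpoch_inf (a * q ^ (M + 2)) q = (1 - a * (Q * q\<^sup>2)) * qpoch_inf (a * q ^ (M + 3)) q"
    "qpoch_inf (a * q ^ (M + 1)) q = (1 - a * (Q * q)) * qpoch_inf (a * q ^ (M + 2)) q" for a
  proof -
    have "a * q ^ (M + 2) * q = a * q ^ (M + 3)" "a * q ^ (M + 1) * q = a * q ^ (M + 2)"
      "Q * q\<^sup>2 = q ^ (M + 2)" "Q * q = q ^ (M + 1)"
      by (simp_all add: Q_def eval_nat_numeral power_add)
    with qpoch_inf_rec[OF assms, of "a * q ^ (M + 2)"] qpoch_inf_rec[OF assms, of "a * q ^ (M + 1)"]
    show "qpoch_inf (a * q ^ (M + 2)) q = (1 - a * (Q * q\<^sup>2)) * qpoch_inf (a * q ^ (M + 3)) q"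
      "qpoch_inf (a * q ^ (M + 1)) q = (1 - a * (Q * q)) * qpoch_inf (a * q ^ (M + 2)) q"
      by (simp_all only:)
  qed
  have P: "qpoch (w * q ^ (M + 3)) q (M + 1) = (1 - w * (Q * q ^ 3)) * qpoch (w * q ^ (M + 4)) q M"
    "qpoch (w * q ^ (M + 2)) q (M + 2)
      = (1 - w * (Q * q\<^sup>2)) * (1 - w * (Q * q ^ 3)) * qpoch (w * q ^ (M + 4)) q M"
    "qpoch (w * q ^ (M + 4)) q (M + 2)
      = (1 - w * (Q\<^sup>2 * q ^ 4)) * (1 - w * (Q\<^sup>2 * q ^ 5)) * qpoch (w * q ^ (M + 4)) q M"
  proof -
    have p: "w * q ^ (M + 3) * q = w * q ^ (M + 4)" "w * q ^ (M + 2) * q = w * q ^ (M + 3)"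
      "Q * q ^ 3 = q ^ (M + 3)" "Q * q\<^sup>2 = q ^ (M + 2)"
      by (simp_all add: Q_def eval_nat_numeral power_add)
    show "qpoch (w * q ^ (M + 3)) q (M + 1) = (1 - w * (Q * q ^ 3)) * qpoch (w * q ^ (M + 4)) q M"
      using qpoch_Suc_left[of "w * q ^ (M + 3)" q M] unfolding p by simp
    moreover have "qpoch (w * q ^ (M + 2)) q (M + 2)
        = (1 - w * (Q * q\<^sup>2)) * qpoch (w * q ^ (M + 3)) q (M + 1)"
      using qpoch_Suc_left[of "w * q ^ (M + 2)" q "M + 1"] unfolding p by simp
    ultimately show "qpoch (w * q ^ (M + 2)) q (M + 2)
        = (1 - w * (Q * q\<^sup>2)) * (1 - w * (Q * q ^ 3)) * qpoch (w * q ^ (M + 4)) q M"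
      by simp
    have "q ^ (M + 4) * q ^ M = Q\<^sup>2 * q ^ 4" "q ^ (M + 4) * q ^ (M + 1) = Q\<^sup>2 * q ^ 5"
      by (simp_all add: Q_def power2_eq_square eval_nat_numeral power_add mult_ac)
    then show "qpoch (w * q ^ (M + 4)) q (M + 2)
        = (1 - w * (Q\<^sup>2 * q ^ 4)) * (1 - w * (Q\<^sup>2 * q ^ 5)) * qpoch (w * q ^ (M + 4)) q M"
      using qpoch_Suc[of "w * q ^ (M + 4)" q M] qpoch_Suc[of "w * q ^ (M + 4)" q "M + 1"]
      by (simp add: mult.assoc)
  qed
  \<comment> \<open>the three summands added in this step, and $V_{M+2}$, as multiples of \<open>K\<close>\<close>
  have new: "product_term q x y (M + 2)
      = K * (Q * q\<^sup>2 * (1 - w * (Q * q\<^sup>2)) * (1 - w * (Q * q ^ 3)))"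
    "product_term q (q * x) (q * y) (M + 1)
      = K * (Q * q * (1 - Q * q\<^sup>2) * (1 - w * (Q * q ^ 3)))"
    "product_term q (q\<^sup>2 * x) (q\<^sup>2 * y) M
      = K * (Q * (1 - Q * q) * (1 - Q * q\<^sup>2))"
  proof -
    have idx: "M + 2 + 1 = M + 3" "M + 1 + 1 = M + 2"
      by simp_all
    have Q: "Q * q ^ 3 = q ^ (M + 3)" "Q * q\<^sup>2 = q ^ (M + 2)" "Q * q = q ^ (M + 1)"
      by (simp_all add: Q_def eval_nat_numeral power_add)
    have E1: "qpoch_inf (q ^ (M + 2)) q = (1 - Q * q\<^sup>2) * qpoch_inf (q ^ (M + 3)) q"
      "qpoch_inf (q ^ (M + 1)) q = (1 - Q * q) * qpoch_inf (q ^ (M + 2)) q"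
      using E[of 1] by simp_all
    show "product_term q x y (M + 2)
        = K * (Q * q\<^sup>2 * (1 - w * (Q * q\<^sup>2)) * (1 - w * (Q * q ^ 3)))"
      unfolding product_term_def idx w_def[symmetric] P K_def Q by (simp only: mult_ac)
    have "q * x * q ^ (M + 2) = x * q ^ (M + 3)" "q * y * q ^ (M + 2) = y * q ^ (M + 3)"
      "q * x * (q * y) * q ^ (M + 1) = w * q ^ (M + 3)"
      by (simp_all add: w_def eval_nat_numeral)
    note shift = this
    show "product_term q (q * x) (q * y) (M + 1)
        = K * (Q * q * (1 - Q * q\<^sup>2) * (1 - w * (Q * q ^ 3)))"
      unfolding product_term_def idx shift P K_def E1 Q by (simp only: mult_ac)
    have "q\<^sup>2 * x * q ^ (M + 1) = x * q ^ (M + 3)" "q\<^sup>2 * y * q ^ (M + 1) = y * q ^ (M + 3)"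
      "q\<^sup>2 * x * (q\<^sup>2 * y) * q ^ M = w * q ^ (M + 4)"
      by (simp_all add: w_def eval_nat_numeral)
    note shift = this
    show "product_term q (q\<^sup>2 * x) (q\<^sup>2 * y) M
        = K * (Q * (1 - Q * q) * (1 - Q * q\<^sup>2))"
      unfolding product_term_def shift K_def E1 Q unfolding Q_def by (simp only: mult_ac)
  qed
  have old: "qpoch_inf (q ^ (M + 2)) q * qpoch_inf (x * q ^ (M + 2)) q * qpoch_inf (y * q ^ (M + 2)) q
      * qpoch (w * q ^ (M + 3)) q (M + 1)
    = K * ((1 - Q * q\<^sup>2) * (1 - x * (Q * q\<^sup>2)) * (1 - y * (Q * q\<^sup>2)) * (1 - w * (Q * q ^ 3)))"
    using E(1)[of 1] unfolding E(1)[of x] E(1)[of y] P K_def by simp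
  have "(\<Sum>n<Suc M + 2. product_term q x y n)
      + q * (x + y) * (\<Sum>n<Suc M + 1. product_term q (q * x) (q * y) n)
      + q ^ 3 * (x * y) * (\<Sum>n<Suc M. product_term q (q\<^sup>2 * x) (q\<^sup>2 * y) n)
    = ((\<Sum>n<M + 2. product_term q x y n)
      + q * (x + y) * (\<Sum>n<M + 1. product_term q (q * x) (q * y) n)
      + q ^ 3 * (x * y) * (\<Sum>n<M. product_term q (q\<^sup>2 * x) (q\<^sup>2 * y) n))
      + (product_term q x y (M + 2) + q * (x + y) * product_term q (q * x) (q * y) (M + 1)
        + q ^ 3 * (x * y) * product_term q (q\<^sup>2 * x) (q\<^sup>2 * y) M)"
    unfolding add_Suc sum.lessThan_Suc by (simp only: distrib_left add_ac)
  also have "\<dots> = K * ((1 - w * (Q\<^sup>2 * q ^ 4)) * (1 - w * (Q\<^sup>2 * q ^ 5)))"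
    unfolding Suc.IH unfolding new w_def[symmetric] old
    unfolding w_def by (simp add: algebra_simps eval_nat_numeral)
  also have "\<dots> = qpoch_inf (q ^ (M + 3)) q * qpoch_inf (x * q ^ (M + 3)) q
      * qpoch_inf (y * q ^ (M + 3)) q * qpoch (w * q ^ (M + 4)) q (M + 2)"
    unfolding P K_def by (simp only: mult_ac)
  finally have step: "(\<Sum>n<Suc M + 2. product_term q x y n)
      + q * (x + y) * (\<Sum>n<Suc M + 1. product_term q (q * x) (q * y) n)
      + q ^ 3 * (x * y) * (\<Sum>n<Suc M. product_term q (q\<^sup>2 * x) (q\<^sup>2 * y) n)
    = qpoch_inf (q ^ (M + 3)) q * qpoch_inf (x * q ^ (M + 3)) q
      * qpoch_inf (y * q ^ (M + 3)) q * qpoch (w * q ^ (M + 4)) q (M + 2)" .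
  have idx: "Suc M + 1 = M + 2" "Suc M + 2 = M + 3" "Suc M + 3 = M + 4"
    by simp_all
  show ?case
    using step unfolding w_def idx .
qed

lemma product_sum_rec:
  assumes "norm q < 1"
  shows "product_sum q x y + q * (x + y) * product_sum q (q * x) (q * y)
    + q ^ 3 * (x * y) * product_sum q (q\<^sup>2 * x) (q\<^sup>2 * y) = 1"
proof (rule LIMSEQ_unique)
  have part: "(\<lambda>M. \<Sum>n<M + k. product_term q a b n) \<longlonglongrightarrow> product_sum q a b" for a b k
    unfolding product_sum_def
    by (rule LIMSEQ_ignore_initial_segment[OF summable_LIMSEQ[OF summable_product_term[OF assms]]])
  show "(\<lambda>M. (\<Sum>n<M + 2. product_term q x y n)
      + q * (x + y) * (\<Sum>n<M + 1. product_term q (q * x) (q * y) n)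
      + q ^ 3 * (x * y) * (\<Sum>n<M. product_term q (q\<^sup>2 * x) (q\<^sup>2 * y) n))
    \<longlonglongrightarrow> product_sum q x y + q * (x + y) * product_sum q (q * x) (q * y)
      + q ^ 3 * (x * y) * product_sum q (q\<^sup>2 * x) (q\<^sup>2 * y)"
    using part[where k = 0] by (intro tendsto_intros part) simp
  have small: "(\<lambda>M. a * q ^ (M + k)) \<longlonglongrightarrow> 0" for a k
    using assms by (intro tendsto_mult_right_zero LIMSEQ_ignore_initial_segment LIMSEQ_power_zero)
  have inf1: "(\<lambda>M. qpoch_inf (a * q ^ (M + 2)) q) \<longlonglongrightarrow> 1" for a
    by (rule tendsto_1_of_qpoch_bound[OF small qpoch_inf_minus_1_le[OF assms]])
  have fin1: "(\<lambda>M. qpoch (x * y * q ^ (M + 3)) q (M + 1)) \<longlonglongrightarrow> 1"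
    by (rule tendsto_1_of_qpoch_bound[OF small qpoch_minus_1_le[OF assms]])
  have "(\<lambda>M. qpoch_inf (1 * q ^ (M + 2)) q * qpoch_inf (x * q ^ (M + 2)) q
      * qpoch_inf (y * q ^ (M + 2)) q * qpoch (x * y * q ^ (M + 3)) q (M + 1)) \<longlonglongrightarrow> 1 * 1 * 1 * 1"
    by (intro tendsto_mult inf1 fin1)
  then show "(\<lambda>M. (\<Sum>n<M + 2. product_term q x y n)
      + q * (x + y) * (\<Sum>n<M + 1. product_term q (q * x) (q * y) n)
      + q ^ 3 * (x * y) * (\<Sum>n<M. product_term q (q\<^sup>2 * x) (q\<^sup>2 * y) n)) \<longlonglongrightarrow> 1"
    unfolding product_term_telescope[OF assms] by simp
qed

section \<open>Uniqueness of bounded solutions\<close>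

text \<open>
  Once the coefficients are below $1/4$, every bound on the tail of the sequence can be halved, so
  the tail vanishes; the recurrence then carries the value zero down to the initial terms.
\<close>

lemma bounded_recurrence_zero:
  fixes d a b :: "nat \<Rightarrow> 'a :: real_normed_algebra"
  assumes rec: "\<And>m. d m = a m * d (Suc m) + b m * d (Suc (Suc m))"
    and "Bseq d" "a \<longlonglongrightarrow> 0" "b \<longlonglongrightarrow> 0"
  shows "d m = 0"
proof -
  have "eventually (\<lambda>m. norm (a m) < 1 / 4 \<and> norm (b m) < 1 / 4) sequentially"
    by (intro eventually_conj order_tendstoD(2)[OF tendsto_norm_zero] assms(3,4)) simp_all
  then obtain N where N: "\<And>m. m \<ge> N \<Longrightarrow> norm (a m) < 1 / 4 \<and> norm (b m) < 1 / 4"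
    by (auto simp: eventually_sequentially)
  obtain C where C: "C > 0" "\<And>m. norm (d m) \<le> C"
    using \<open>Bseq d\<close> by (auto elim!: BseqE)
  have halving: "m \<ge> N \<Longrightarrow> norm (d m) \<le> C * (1 / 2) ^ k" for k m
  proof (induction k arbitrary: m)
    case 0
    then show ?case using C by simp
  next
    case (Suc k)
    have "norm (d m) \<le> norm (a m * d (Suc m)) + norm (b m * d (Suc (Suc m)))"
      by (subst rec) (rule norm_triangle_ineq)
    also have "\<dots> \<le> norm (a m) * norm (d (Suc m)) + norm (b m) * norm (d (Suc (Suc m)))"
      by (intro add_mono norm_mult_ineq)
    also have "\<dots> \<le> 1 / 4 * (C * (1 / 2) ^ k) + 1 / 4 * (C * (1 / 2) ^ k)"
      using N[OF Suc.prems] Suc C(1) by (intro add_mono mult_mono) auto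
    finally show ?case by simp
  qed
  have tail: "d m = 0" if "m \<ge> N" for m
  proof -
    have "(\<lambda>k. C * (1 / 2) ^ k) \<longlonglongrightarrow> 0"
      by (intro tendsto_mult_right_zero LIMSEQ_power_zero) simp
    then have "norm (d m) \<le> 0"
      by (rule LIMSEQ_le_const) (use halving[OF that] in blast)
    then show ?thesis by simp
  qed
  \<comment> \<open>two consecutive zeros are needed to go one step down\<close>
  have "d (N - k) = 0 \<and> d (Suc (N - k)) = 0" for k
  proof (induction k)
    case 0
    then show ?case by (simp add: tail)
  next
    case (Suc k)
    then show ?case
      using rec[of "N - Suc k"] by (cases "k < N") (simp_all add: Suc_diff_Suc)
  qed
  from this[of "N - m"] show "d m = 0"
    using tail[of m] by (cases "m \<ge> N") simp_all
qed

lemma product_sum_eq_theta_quotient: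
  assumes "norm q < 1" "q \<noteq> 0" "x \<noteq> y"
  shows "product_sum q x y = theta_quotient q x y"
proof -
  define d where "d = (\<lambda>m. product_sum q (q ^ m * x) (q ^ m * y)
    - theta_quotient q (q ^ m * x) (q ^ m * y))"
  have "d m = - (q ^ Suc m * (x + y)) * d (Suc m) + - (q ^ (2 * m + 3) * (x * y)) * d (Suc (Suc m))" for m
  proof -
    have arg: "q * (q ^ m * z) = q ^ Suc m * z" "q\<^sup>2 * (q ^ m * z) = q ^ Suc (Suc m) * z" for z
      by (simp_all add: power2_eq_square)
    have coeff: "q * (q ^ m * x + q ^ m * y) = q ^ Suc m * (x + y)"
      "q ^ 3 * (q ^ m * x * (q ^ m * y)) = q ^ (2 * m + 3) * (x * y)"
      by (simp_all add: algebra_simps power_add power_mult power2_eq_square)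
    have "q ^ m * x \<noteq> q ^ m * y"
      using assms(2,3) by simp
    note recs = product_sum_rec[OF assms(1), of "q ^ m * x" "q ^ m * y", unfolded arg coeff]
      theta_quotient_rec[OF assms(1,2) this, unfolded arg coeff]
    have "p - t = - c * (p' - t') + - e * (p'' - t'')"
      if "p + c * p' + e * p'' = 1" "t + c * t' + e * t'' = 1" for c e p p' p'' t t' t'' :: complex
    proof -
      have "p = 1 - c * p' - e * p''" "t = 1 - c * t' - e * t''"
        using that by (simp_all add: eq_diff_eq add_ac)
      then show ?thesis by (simp only:) (simp add: algebra_simps)
    qed
    from this[OF recs] show ?thesis
      unfolding d_def .
  qed
  moreover have "Bseq d"
  proof -
    obtain A where A: "norm (product_sum q (q ^ m * x) (q ^ m * y)) \<le> A" for m
      using Bseq_product_sum[OF assms(1)] unfolding Bseq_def by blast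
    obtain B where B: "norm (theta_quotient q (q ^ m * x) (q ^ m * y)) \<le> B" for m
      using Bseq_theta_quotient[OF assms(1,2)] unfolding Bseq_def by blast
    have "norm (d m) \<le> A + B" for m
      unfolding d_def by (rule order_trans[OF norm_triangle_ineq4 add_mono[OF A B]])
    then show ?thesis by (rule BseqI')
  qed
  moreover have "(\<lambda>m. - (c m * z)) \<longlonglongrightarrow> 0" if "c \<longlonglongrightarrow> 0" for c :: "nat \<Rightarrow> complex" and z
    using tendsto_minus[OF tendsto_mult_left_zero[OF that]] by simp
  moreover have "(\<lambda>m. q ^ Suc m) \<longlonglongrightarrow> 0"
    by (rule LIMSEQ_Suc[OF LIMSEQ_power_zero[OF assms(1)]])
  moreover have "(\<lambda>m. q ^ (2 * m + 3)) \<longlonglongrightarrow> 0"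
    using LIMSEQ_subseq_LIMSEQ[OF LIMSEQ_power_zero[OF assms(1)], of "\<lambda>m. 2 * m + 3"]
    by (simp add: strict_mono_def comp_def)
  ultimately have "d 0 = 0"
    by (intro bounded_recurrence_zero[where d = d and a = "\<lambda>m. - (q ^ Suc m * (x + y))"
      and b = "\<lambda>m. - (q ^ (2 * m + 3) * (x * y))"]) blast+
  then show ?thesis by (simp add: d_def)
qed

theorem theorem1:
  fixes q x y :: complex
  assumes "0 < norm q" and "norm q < 1"
    and "x \<noteq> y"
    and "\<And>k::nat. x * q ^ (k + 1) \<noteq> 1"
    and "\<And>k::nat. y * q ^ (k + 1) \<noteq> 1"
    and "\<And>k::nat. x * y * q ^ k \<noteq> 1"
  defines "f \<equiv> \<lambda>n::nat. (-1) ^ n * q ^ (n * (n - 1) div 2) * ((x ^ n - y ^ n) / (x - y))"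
    and "g \<equiv> \<lambda>n::nat. qpoch (x * y) q (2 * n) * q ^ n / qpochs [q, q * x, q * y, x * y] q n"
  shows "summable (\<lambda>n. f (n + 1)) \<and> summable g \<and>
    (\<Sum>n. f (n + 1)) = - qpochs_inf [q, q * x, q * y] q * (\<Sum>n. g n)"
proof -
  let ?t = "\<lambda>z n. (-1) ^ n * q ^ (n * (n + 1) div 2) * z ^ n"
  have "q \<noteq> 0" using assms(1) by auto
  have f: "f (n + 1) = - ((x * ?t x n - y * ?t y n) / (x - y))" for n
  proof -
    have "(n + 1) * (n + 1 - 1) div 2 = n * (n + 1) div 2" by (simp add: mult.commute)
    then show ?thesis unfolding f_def by (simp add: field_simps)
  qed
  have f_sums: "(\<lambda>n. f (n + 1)) sums (- theta_quotient q x y)"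
    unfolding f theta_quotient_def partial_theta_def
    by (intro sums_minus sums_divide sums_diff sums_mult summable_sums summable_partial_theta assms)
  have q_powers: "q * q ^ k \<noteq> 1" for k
    using assms(2) power_Suc_less_one[of "norm q" k]
    by (metis norm_ge_zero norm_mult norm_one norm_power less_irrefl power_Suc power_0 assms(1))
  have g: "qpochs_inf [q, q * x, q * y] q * g n = product_term q x y n" for n
  proof -
    have ne: "qpoch q q n \<noteq> 0" "qpoch (q * x) q n \<noteq> 0" "qpoch (q * y) q n \<noteq> 0" "qpoch (x * y) q n \<noteq> 0"
      using q_powers assms(4-6) by (auto intro!: qpoch_nonzero simp: mult_ac)
    have inf: "qpoch_inf (q * z) q = qpoch (q * z) q n * qpoch_inf (z * q ^ (n + 1)) q" for z
      using qpoch_inf_split[OF assms(2), of "q * z" n] by (simp add: mult_ac)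
    have "qpoch (x * y) q (2 * n) = qpoch (x * y) q n * qpoch (x * y * q ^ n) q n"
      using qpoch_add[of "x * y" q n n] by (simp add: mult_2)
    then show ?thesis
      using ne inf[of 1] inf[of x] inf[of y]
      by (simp add: g_def qpochs_def qpochs_inf_def product_term_def)
  qed
  have ne: "qpochs_inf [q, q * x, q * y] q \<noteq> 0"
    using qpoch_inf_nonzero[OF assms(2)] q_powers assms(4,5)
    by (auto simp: qpochs_inf_def mult_ac)
  have "(\<lambda>n. product_term q x y n / qpochs_inf [q, q * x, q * y] q)
      sums (product_sum q x y / qpochs_inf [q, q * x, q * y] q)"
    unfolding product_sum_def
    by (intro sums_divide summable_sums summable_product_term assms)
  then have "g sums (product_sum q x y / qpochs_inf [q, q * x, q * y] q)"
    using ne by (simp flip: g)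
  moreover have "product_sum q x y = theta_quotient q x y"
    using product_sum_eq_theta_quotient[OF assms(2) \<open>q \<noteq> 0\<close> assms(3)] .
  ultimately have "summable g" "qpochs_inf [q, q * x, q * y] q * (\<Sum>n. g n) = theta_quotient q x y"
    using ne by (simp_all add: sums_summable sums_unique[symmetric])
  with f_sums show ?thesis
    by (simp add: sums_summable sums_unique[symmetric])
qed

end
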